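(* Let $\mathcal{A}$ be an associative commutative algebra over a field of characteristic $0$, and suppose that $\mathcal{A}$ contains no nonzero nilpotent elements. Let $n$ be a positive integer. Then every $n$-ary Nambu-Loday bracket $\{\cdot,\dots,\cdot\}:\mathcal{A}\times\cdots\times\mathcal{A}\to\mathcal{A}$ is skew-symmetric.
   Context: Let $\mathcal{A}$ be an associative commutative algebra over a field $\mathbb{K}$ (a unit is not assumed). An $n$-ary bracket on $\mathcal{A}$ is a map $\mathcal{A}^n\to\mathcal{A}$, $(f_1,\dots,f_n)\mapsto\{f_1,\dots,f_n\}$, that is $\mathbb{K}$-linear in each argument separately. No symmetry or skew-symmetry is assumed. An $n$-ary bracket is called a Nambu-Loday bracket if it satisfies the following two conditions. (i) Leibniz rule in each argument: for all $i=1,\dots,n$ and all $f_1,\dots,f_n,f_i'\in\mathcal{A}$, $$\{f_1,\dots,f_if_i',\dots,f_n\}=f_i\{f_1,\dots,f_i',\dots,f_n\}+\{f_1,\dots,f_i,\dots,f_n\}f_i'.$$ (ii) Filippov identity: for all $f_1,\dots,f_{n-1},g_1,\dots,g_n\in\mathcal{A}$, $$\{f_1,\dots,f_{n-1},\{g_1,\dots,g_n\}\}=\sum_{k=1}^n\{g_1,\dots,g_{k-1},\{f_1,\dots,f_{n-1},g_k\},g_{k+1},\dots,g_n\}.$$ The bracket is skew-symmetric if interchanging any two arguments (in positions $i\neq j$) changes the sign of the bracket. *)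

theory Defs
  imports Complex_Main
begin

text \<open>The class \<open>comm_ring\<close> does not provide a unit.\<close>

locale commutative_algebra = vector_space scale
  for scale :: "'k::field \<Rightarrow> 'a::comm_ring \<Rightarrow> 'a" +
  assumes scale_mult: "scale c (x * y) = scale c x * y"

text \<open>Without a unit the class \<open>power\<close> is not available; \<open>((*) x ^^ m) x\<close> is the product of
  \<open>m + 1\<close> copies of \<open>x\<close>.\<close>

definition nilpotent_element :: "'a::comm_ring \<Rightarrow> bool" where
  "nilpotent_element x \<longleftrightarrow> (\<exists>m. ((*) x ^^ m) x = 0)"

lemma funpow_times_eq_power:
  fixes x :: "'a::comm_ring_1"
  shows "((*) x ^^ m) x = x ^ Suc m"
  by (induction m) simp_all

text \<open>An \<open>n\<close>-tuple is a list of length \<open>n\<close>, with positions \<open>0, \<dots>, n - 1\<close>. The values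
  of a bracket on lists of any other length are irrelevant.\<close>

definition multilinear_bracket ::
    "('k::field \<Rightarrow> 'a::ab_group_add \<Rightarrow> 'a) \<Rightarrow> nat \<Rightarrow> ('a list \<Rightarrow> 'a) \<Rightarrow> bool" where
  "multilinear_bracket scale n br \<longleftrightarrow>
     (\<forall>fs i. length fs = n \<longrightarrow> i < n \<longrightarrow>
        Vector_Spaces.linear scale scale (\<lambda>a. br (fs[i := a])))"

definition leibniz_rule :: "nat \<Rightarrow> ('a::comm_ring list \<Rightarrow> 'a) \<Rightarrow> bool" where
  "leibniz_rule n br \<longleftrightarrow>
     (\<forall>fs i a b. length fs = n \<longrightarrow> i < n \<longrightarrow>
        br (fs[i := a * b]) = a * br (fs[i := b]) + br (fs[i := a]) * b)"

definition filippov_identity :: "nat \<Rightarrow> ('a::comm_monoid_add list \<Rightarrow> 'a) \<Rightarrow> bool" where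
  "filippov_identity n br \<longleftrightarrow>
     (\<forall>fs gs. length fs = n - 1 \<longrightarrow> length gs = n \<longrightarrow>
        br (fs @ [br gs]) = (\<Sum>k<n. br (gs[k := br (fs @ [gs ! k])])))"

definition nambu_loday_bracket ::
    "('k::field \<Rightarrow> 'a::comm_ring \<Rightarrow> 'a) \<Rightarrow> nat \<Rightarrow> ('a list \<Rightarrow> 'a) \<Rightarrow> bool" where
  "nambu_loday_bracket scale n br \<longleftrightarrow>
     multilinear_bracket scale n br \<and> leibniz_rule n br \<and> filippov_identity n br"

definition skew_symmetric_bracket :: "nat \<Rightarrow> ('a::ab_group_add list \<Rightarrow> 'a) \<Rightarrow> bool" where
  "skew_symmetric_bracket n br \<longleftrightarrow>
     (\<forall>fs i j. length fs = n \<longrightarrow> i < n \<longrightarrow> j < n \<longrightarrow> i \<noteq> j \<longrightarrow>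
        br (fs[i := fs ! j, j := fs ! i]) = - br fs)"

end

theory Submission imports Defs begin

text \<open>
  Write \<open>X = {f\<^sub>1, \<dots>, f\<^sub>n\<^sub>-\<^sub>1, \<cdot>}\<close>. The Filippov identity says that \<open>X\<close> acts as a derivation of the
  bracket, and it says so for every choice of the \<open>f\<^sub>i\<close>. Put \<open>x\<^sup>2\<close> in place of \<open>x = f\<^sub>i\<close>: by the
  Leibniz rule \<open>X\<close> becomes \<open>2 x X\<close>, and \<open>x X\<close> can act as a derivation of the bracket, like \<open>X\<close>
  itself, only if the terms in which the bracket differentiates the factor \<open>x\<close> cancel:
  \<open>\<Sum>\<^sub>k X(g\<^sub>k) {g\<^sub>1, \<dots>, x, \<dots>, g\<^sub>n} = 0\<close>, with \<open>x\<close> in position \<open>k\<close>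
  (lemma \<open>leibniz_filippov_quadratic_identity\<close>).

  This quadratic identity finishes the proof without further differentiation. Let
  \<open>c = X(x) = {f\<^sub>1, \<dots>, f\<^sub>n\<^sub>-\<^sub>1, x}\<close>. If \<open>x\<close> occurs in exactly \<open>s\<close> of the \<open>g\<^sub>k\<close>, the identity expresses
  \<open>s c {g\<^sub>1, \<dots>, g\<^sub>n}\<close> through brackets in which \<open>x\<close> occurs \<open>s + 1\<close> times. By induction \<open>c\<close> kills
  every bracket that has \<open>x\<close> among its entries; one can divide by \<open>s > 0\<close> in characteristic \<open>0\<close>, and
  \<open>c\<^sup>2 z = 0\<close> forces \<open>c z = 0\<close> when there are no nilpotents
  (lemma \<open>diagonal_value_annihilates\<close>). But \<open>c\<close> itself is such a bracket, so \<open>c\<^sup>2 = 0\<close> and \<open>c = 0\<close>.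

  Thus the bracket vanishes as soon as its last entry equals another one. Polarization gives the sign
  change under the transpositions \<open>(i n)\<close>, and \<open>(i j) = (i n)(j n)(i n)\<close> gives the others.
\<close>

section \<open>Reducedness, torsion and additivity\<close>

lemma reduced_square_zeroD:
  fixes x :: "'a::comm_ring"
  assumes reduced: "\<And>x::'a. nilpotent_element x \<Longrightarrow> x = 0"
    and "x * x = 0"
  shows "x = 0"
proof (rule reduced)
  have "((*) x ^^ 1) x = 0"
    using assms(2) by simp
  then show "nilpotent_element x"
    unfolding nilpotent_element_def by blast
qed

lemma (in vector_space) sum_constant_eq_0D:
  fixes u :: 'b
  assumes "(\<Sum>k\<in>S. u) = 0" and "of_nat (card S) \<noteq> (0::'a)"
  shows "u = 0"
proof -
  have "scale (of_nat (card S)) u = 0"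
    using assms(1) by (simp only: sum_constant_scale)
  with assms(2) show ?thesis
    by simp
qed

lemma multilinear_bracket_add:
  assumes "multilinear_bracket scale n br" "length fs = n" "i < n"
  shows "br (fs[i := a + b]) = br (fs[i := a]) + br (fs[i := b])"
proof -
  have "Vector_Spaces.linear scale scale (\<lambda>a. br (fs[i := a]))"
    using assms unfolding multilinear_bracket_def by blast
  then show ?thesis
    by (rule Vector_Spaces.linear.axioms(3)[THEN module_hom.add])
qed

section \<open>The quadratic identity and its consequence\<close>

text \<open>
  Evaluate the Filippov identity at \<open>fs[i := x * x]\<close>, where \<open>x\<close> is the entry already in position \<open>i\<close>,
  and subtract twice the product of \<open>x\<close> with the identity at \<open>fs\<close>. What survives on the right are the
  terms in which an outer bracket differentiates \<open>x\<close>. They come with a factor \<open>2\<close>, from the two equal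
  factors of \<open>x * x\<close>, which is why torsion has to be excluded.
\<close>

lemma leibniz_filippov_quadratic_identity:
  fixes br :: "'a::comm_ring list \<Rightarrow> 'a"
  assumes add: "\<And>gs k a b. length gs = n \<Longrightarrow> k < n \<Longrightarrow>
                  br (gs[k := a + b]) = br (gs[k := a]) + br (gs[k := b])"
    and leibniz: "leibniz_rule n br"
    and filippov: "filippov_identity n br"
    and two: "\<And>u::'a. u + u = 0 \<Longrightarrow> u = 0"
    and fs: "length fs = n - 1" and i: "i < n - 1" and gs: "length gs = n"
  shows "(\<Sum>k<n. br (fs @ [gs ! k]) * br (gs[k := fs ! i])) = 0"
proof -
  define x where "x = fs ! i"
  define X where "X = (\<lambda>h. br (fs @ [h]))"
  have X_square: "br (fs[i := x * x] @ [h]) = x * X h + x * X h" for h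
  proof -
    have "br ((fs @ [h])[i := x * x]) =
        x * br ((fs @ [h])[i := x]) + br ((fs @ [h])[i := x]) * x"
      using leibniz fs i unfolding leibniz_rule_def by simp
    then show ?thesis
      using fs i by (simp add: list_update_append x_def X_def mult.commute)
  qed
  have filippov_X: "X (br gs) = (\<Sum>k<n. br (gs[k := X (gs ! k)]))"
    using filippov fs gs unfolding filippov_identity_def X_def by blast
  have slot: "br (gs[k := x * h + x * h]) =
      (x * br (gs[k := h]) + x * br (gs[k := h])) + (h * br (gs[k := x]) + h * br (gs[k := x]))"
    if "k < n" for k h
  proof -
    have "br (gs[k := x * h]) = x * br (gs[k := h]) + br (gs[k := x]) * h"
      using leibniz gs that unfolding leibniz_rule_def by blast
    then show ?thesis
      using add[OF gs that] by (simp add: algebra_simps)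
  qed
  have "x * X (br gs) + x * X (br gs) = br (fs[i := x * x] @ [br gs])"
    by (simp add: X_square)
  also have "\<dots> = (\<Sum>k<n. br (gs[k := br (fs[i := x * x] @ [gs ! k])]))"
    using filippov fs gs unfolding filippov_identity_def by simp
  also have "\<dots> = (\<Sum>k<n. (x * br (gs[k := X (gs ! k)]) + x * br (gs[k := X (gs ! k)])) +
      (X (gs ! k) * br (gs[k := x]) + X (gs ! k) * br (gs[k := x])))"
    by (intro sum.cong) (simp_all add: X_square slot)
  also have "\<dots> = (x * X (br gs) + x * X (br gs)) +
      ((\<Sum>k<n. X (gs ! k) * br (gs[k := x])) + (\<Sum>k<n. X (gs ! k) * br (gs[k := x])))"
    by (simp add: filippov_X sum.distrib sum_distrib_left)
  finally have "(\<Sum>k<n. X (gs ! k) * br (gs[k := x])) + (\<Sum>k<n. X (gs ! k) * br (gs[k := x])) = 0"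
    by simp
  then have "(\<Sum>k<n. X (gs ! k) * br (gs[k := x])) = 0"
    by (rule two)
  then show ?thesis
    by (simp add: X_def x_def)
qed

text \<open>
  For linear \<open>\<phi>\<close> and multilinear \<open>br\<close>, at a point where \<open>\<phi> x\<close> is invertible, the quadratic identity
  makes the bracket factor through the projection along \<open>x\<close> onto the kernel of \<open>\<phi>\<close>, so that it vanishes whenever \<open>x\<close> is among its
  arguments. The induction, on the number of entries different from \<open>x\<close>, expresses this without
  passing to points.
\<close>

lemma diagonal_value_annihilates:
  fixes br :: "'a::comm_ring list \<Rightarrow> 'a" and \<phi> :: "'a \<Rightarrow> 'a"
  assumes quadratic: "\<And>gs. length gs = n \<Longrightarrow> (\<Sum>k<n. \<phi> (gs ! k) * br (gs[k := x])) = 0"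
    and torsion_free: "\<And>(S::nat set) u::'a. finite S \<Longrightarrow> S \<noteq> {} \<Longrightarrow> (\<Sum>k\<in>S. u) = 0 \<Longrightarrow> u = 0"
    and reduced: "\<And>z::'a. z * z = 0 \<Longrightarrow> z = 0"
    and "length gs = n" and "x \<in> set gs"
  shows "\<phi> x * br gs = 0"
  using assms(4,5)
proof (induction "card {k. k < n \<and> gs ! k \<noteq> x}" arbitrary: gs rule: less_induct)
  case less
  define c where "c = \<phi> x"
  define S where "S = {k. k < n \<and> gs ! k = x}"
  define R where "R = {k. k < n \<and> gs ! k \<noteq> x}"
  have S: "finite S" "S \<noteq> {}"
    using less.prems unfolding S_def by (auto simp: in_set_conv_nth)
  have split: "{..<n} = S \<union> R" "S \<inter> R = {}" "finite R"
    unfolding S_def R_def by auto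
  have step: "c * br (gs[k := x]) = 0" if k: "k \<in> R" for k
  proof -
    have "{l. l < n \<and> gs[k := x] ! l \<noteq> x} \<subset> R"
      using k less.prems(1) unfolding R_def by (auto simp: nth_list_update split: if_splits)
    then have "card {l. l < n \<and> gs[k := x] ! l \<noteq> x} < card R"
      using split(3) by (rule psubset_card_mono[rotated])
    moreover have "x \<in> set (gs[k := x])"
      using k less.prems(1) unfolding R_def by (auto intro: set_update_memI)
    ultimately show ?thesis
      using less.hyps[of "gs[k := x]"] less.prems(1) unfolding R_def c_def by simp
  qed
  have "0 = c * (\<Sum>k<n. \<phi> (gs ! k) * br (gs[k := x]))"
    using quadratic[OF less.prems(1)] by simp
  also have "\<dots> = (\<Sum>k\<in>S. c * (\<phi> (gs ! k) * br (gs[k := x]))) +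
      (\<Sum>k\<in>R. c * (\<phi> (gs ! k) * br (gs[k := x])))"
    using split S(1) by (simp add: sum_distrib_left distrib_left sum.union_disjoint)
  also have "(\<Sum>k\<in>R. c * (\<phi> (gs ! k) * br (gs[k := x]))) = 0"
  proof (rule sum.neutral, intro ballI)
    fix k assume "k \<in> R"
    have "c * (\<phi> (gs ! k) * br (gs[k := x])) = \<phi> (gs ! k) * (c * br (gs[k := x]))"
      by (simp add: mult.left_commute)
    with step[OF \<open>k \<in> R\<close>] show "c * (\<phi> (gs ! k) * br (gs[k := x])) = 0"
      by simp
  qed
  also have "(\<Sum>k\<in>S. c * (\<phi> (gs ! k) * br (gs[k := x]))) = (\<Sum>k\<in>S. c * (c * br gs))"
  proof (rule sum.cong[OF refl])
    fix k assume "k \<in> S"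
    then have "gs ! k = x" "gs[k := x] = gs"
      unfolding S_def by (auto intro: list_update_same_conv[THEN iffD2] simp: less.prems)
    then show "c * (\<phi> (gs ! k) * br (gs[k := x])) = c * (c * br gs)"
      by (simp add: c_def)
  qed
  finally have "c * (c * br gs) = 0"
    using torsion_free[OF S] by simp
  moreover have "(c * br gs) * (c * br gs) = (c * (c * br gs)) * br gs"
    by (simp only: mult_ac)
  ultimately have "(c * br gs) * (c * br gs) = 0"
    by simp
  then show ?case
    unfolding c_def by (rule reduced)
qed

section \<open>From vanishing on diagonals to skew-symmetry\<close>

lemma alternating_imp_transposition_neg:
  fixes br :: "'a::ab_group_add list \<Rightarrow> 'a"
  assumes add: "\<And>gs k a b. length gs = n \<Longrightarrow> k < n \<Longrightarrow>
                  br (gs[k := a + b]) = br (gs[k := a]) + br (gs[k := b])"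
    and alt: "\<And>gs. length gs = n \<Longrightarrow> gs ! i = gs ! j \<Longrightarrow> br gs = 0"
    and ij: "i < n" "j < n" "i \<noteq> j" and fs: "length fs = n"
  shows "br (fs[i := fs ! j, j := fs ! i]) = - br fs"
proof -
  define B where "B = (\<lambda>a b. br (fs[i := a, j := b]))"
  have diag: "B a a = 0" for a
    unfolding B_def using ij fs by (intro alt) (auto simp: nth_list_update)
  have add_right: "B a (b + c) = B a b + B a c" for a b c
    unfolding B_def using ij fs by (intro add) auto
  have add_left: "B (a + b) c = B a c + B b c" for a b c
    unfolding B_def using ij fs add[of "fs[j := c]" i a b]
    by (simp add: list_update_swap[of i j])
  have "B (fs ! i + fs ! j) (fs ! i + fs ! j) = B (fs ! i) (fs ! j) + B (fs ! j) (fs ! i)"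
    by (simp only: add_left add_right) (simp add: diag)
  then have "B (fs ! i) (fs ! j) + B (fs ! j) (fs ! i) = 0"
    by (simp add: diag)
  moreover have "B (fs ! i) (fs ! j) = br fs"
    unfolding B_def by simp
  ultimately have "B (fs ! j) (fs ! i) = - br fs"
    by (simp add: add_eq_0_iff)
  then show ?thesis
    unfolding B_def .
qed

text \<open>The transpositions with one fixed position \<open>p\<close> suffice, because \<open>(i j) = (i p)(j p)(i p)\<close> is a
  product of an odd number of them.\<close>

lemma skew_symmetric_bracket_via_fixed_position:
  fixes br :: "'a::ab_group_add list \<Rightarrow> 'a"
  assumes p: "p < n"
    and swap: "\<And>fs i. length fs = n \<Longrightarrow> i < n \<Longrightarrow> i \<noteq> p \<Longrightarrow>
                 br (fs[i := fs ! p, p := fs ! i]) = - br fs"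
  shows "skew_symmetric_bracket n br"
  unfolding skew_symmetric_bracket_def
proof (intro allI impI)
  fix fs :: "'a list" and i j
  assume fs: "length fs = n" and ij: "i < n" "j < n" "i \<noteq> j"
  consider "i = p" | "j = p" | "i \<noteq> p" "j \<noteq> p"
    by blast
  then show "br (fs[i := fs ! j, j := fs ! i]) = - br fs"
  proof cases
    case 1
    then show ?thesis
      using swap[of fs j] fs ij by (simp add: list_update_swap[of p j])
  next
    case 2
    then show ?thesis
      using swap[of fs i] fs ij by simp
  next
    case 3
    define g where "g = fs[i := fs ! p, p := fs ! i]"
    define h where "h = g[j := g ! p, p := g ! j]"
    have len: "length g = n" "length h = n"
      using fs by (simp_all add: g_def h_def)
    have "fs[i := fs ! j, j := fs ! i] = h[i := h ! p, p := h ! i]"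
      unfolding h_def g_def using fs ij 3 p
      by (intro nth_equalityI) (auto simp: nth_list_update)
    moreover have "br (h[i := h ! p, p := h ! i]) = - br h"
      using swap[OF len(2)] ij 3 by simp
    moreover have "br h = - br g"
      unfolding h_def using swap[OF len(1)] ij 3 by simp
    moreover have "br g = - br fs"
      unfolding g_def using swap[OF fs] ij 3 by simp
    ultimately show ?thesis
      by simp
  qed
qed

section \<open>Skew-symmetry of Nambu-Loday brackets\<close>

theorem theorem1:
  fixes scale :: "'k::field_char_0 \<Rightarrow> 'a::comm_ring \<Rightarrow> 'a"
    and n :: nat
    and br :: "'a list \<Rightarrow> 'a"
  assumes "commutative_algebra scale"
    and "\<And>x::'a. nilpotent_element x \<Longrightarrow> x = 0"
    and "n \<ge> 1"
    and "nambu_loday_bracket scale n br"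
  shows "skew_symmetric_bracket n br"
proof -
  interpret commutative_algebra scale
    by (rule assms(1))
  have reduced: "z = 0" if "z * z = 0" for z :: 'a
    using assms(2) that by (rule reduced_square_zeroD)
  have torsion_free: "u = 0" if "finite S" "S \<noteq> {}" "(\<Sum>k\<in>S. u) = 0" for S :: "nat set" and u :: 'a
    using that by (intro sum_constant_eq_0D[OF that(3)]) simp_all
  have two: "u = 0" if "u + u = 0" for u :: 'a
    using torsion_free[of "{0, 1}" u] that by simp
  have multilinear: "multilinear_bracket scale n br"
    and leibniz: "leibniz_rule n br" and filippov: "filippov_identity n br"
    using assms(4) unfolding nambu_loday_bracket_def by blast+
  note add = multilinear_bracket_add[OF multilinear]
  have alternating: "br gs = 0"
    if gs: "length gs = n" and i: "i < n - 1" and eq: "gs ! i = gs ! (n - 1)" for gs i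
  proof -
    define fs where "fs = butlast gs"
    define x where "x = gs ! i"
    have fs: "length fs = n - 1" "fs ! i = x"
      using gs i by (simp_all add: fs_def x_def nth_butlast)
    have "gs \<noteq> []"
      using gs assms(3) by auto
    then have gs_eq: "gs = fs @ [x]"
      using append_butlast_last_id[of gs] eq gs by (simp add: fs_def x_def last_conv_nth)
    have "br (fs @ [x]) * br gs = 0"
    proof (rule diagonal_value_annihilates[where \<phi> = "\<lambda>h. br (fs @ [h])" and n = n])
      show "(\<Sum>k<n. br (fs @ [hs ! k]) * br (hs[k := x])) = 0" if "length hs = n" for hs
        using leibniz_filippov_quadratic_identity[OF add leibniz filippov two fs(1) i that] fs(2)
        by simp
      show "u = 0" if "finite S" "S \<noteq> {}" "(\<Sum>k\<in>S. u) = 0" for S :: "nat set" and u :: 'a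
        using that by (rule torsion_free)
      show "z = 0" if "z * z = 0" for z :: 'a
        using that by (rule reduced)
      show "length gs = n" "x \<in> set gs"
        using gs by (simp_all add: gs_eq)
    qed
    then have "br gs * br gs = 0"
      unfolding gs_eq .
    then show ?thesis
      by (rule reduced)
  qed
  show ?thesis
  proof (rule skew_symmetric_bracket_via_fixed_position[of "n - 1"])
    show "n - 1 < n"
      using assms(3) by simp
    show "br (fs[i := fs ! (n - 1), n - 1 := fs ! i]) = - br fs"
      if "length fs = n" "i < n" "i \<noteq> n - 1" for fs i
    proof (rule alternating_imp_transposition_neg[of n br, OF add])
      show "br gs = 0" if "length gs = n" "gs ! i = gs ! (n - 1)" for gs
        using that \<open>i < n\<close> \<open>i \<noteq> n - 1\<close> by (intro alternating[of gs i]) simp_all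
    qed (use that in simp_all)
  qed
qed

end
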